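(* Let $n\ge2$. If $f$ is nonnegative and integrable on the unit sphere $S^{n-1}$ with $\int_{S^{n-1}}f\,dS>0$, then a unique point $x\in\mathbb{B}^n$ exists such that each component of $T_x$ is orthogonal to $f$, meaning $$\int_{S^{n-1}}T_x(y)\,f(y)\,dS(y)=0.$$
   Context: $\mathbb{B}^n$ is the open unit ball centered at the origin in $\mathbb{R}^n$, $\overline{\mathbb{B}^n}$ its closure, $S^{n-1}=\partial\mathbb{B}^n$, and $dS$ is the surface area measure on $S^{n-1}$. For $x\in\mathbb{B}^n$ the M\"obius transformation $T_x:\overline{\mathbb{B}^n}\to\overline{\mathbb{B}^n}$ is $$T_x(y)=\frac{(1+2x\cdot y+|y|^2)x+(1-|x|^2)y}{1+2x\cdot y+|x|^2|y|^2},\qquad y\in\overline{\mathbb{B}^n}.$$ *)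

theory Defs
  imports "HOL-Analysis.Analysis"
begin

text \<open>
  Surface area measure on the unit sphere. The area of a Borel set \<open>A\<close> of unit vectors is
  \<open>n\<close> times the volume of the cone \<open>{r *\<^sub>R y | 0 < r < 1, y \<in> A}\<close>, which is the normalization
  \<open>dx = r ^ (n - 1) dr dS\<close> of integration in polar coordinates. The preimage of \<open>A\<close> under
  \<^term>\<open>sgn\<close>, the radial projection \<open>x / norm x\<close>, on the punctured unit ball is this cone.
  The measure is completed, so that integrability does not require Borel measurability.
\<close>

definition surface_measure :: "'a::euclidean_space measure" where
  "surface_measure =
     completion (scale_measure (of_nat DIM('a))
       (distr (restrict_space lborel (ball 0 1 - {0})) (restrict_space borel (sphere 0 1)) sgn))"

lemma space_surface_measure [simp]: "space surface_measure = sphere 0 1"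
  by (simp add: surface_measure_def space_restrict_space space_scale_measure)

lemma emeasure_surface_measure:
  fixes A :: "'a::euclidean_space set"
  assumes "A \<in> sets borel" "A \<subseteq> sphere 0 1"
  shows "emeasure surface_measure A =
           of_nat DIM('a) * emeasure lborel {r *\<^sub>R y | r y. 0 < r \<and> r < 1 \<and> y \<in> A}"
proof -
  have meas: "sgn \<in> restrict_space lborel (ball 0 1 - {0::'a}) \<rightarrow>\<^sub>M restrict_space borel (sphere 0 1)"
    by (intro measurable_restrict_space3) (auto simp: norm_sgn)
  have A: "A \<in> sets (restrict_space borel (sphere 0 1))"
    using assms by (auto simp: sets_restrict_space_iff)
  have cone: "sgn -` A \<inter> (ball 0 1 - {0}) = {r *\<^sub>R y | r y. 0 < r \<and> r < 1 \<and> y \<in> A}" (is "?L = ?R")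
  proof (intro equalityI subsetI)
    fix x assume x: "x \<in> ?L"
    then have "x = norm x *\<^sub>R sgn x" "0 < norm x" "norm x < 1" "sgn x \<in> A"
      by (auto simp: sgn_div_norm)
    then show "x \<in> ?R" by blast
  next
    fix x assume "x \<in> ?R"
    then obtain r y where *: "x = r *\<^sub>R y" "0 < r" "r < 1" "y \<in> A" by blast
    with assms(2) have "norm y = 1" by auto
    with * show "x \<in> ?L" by (auto simp: sgn_div_norm)
  qed
  have "sgn -` A \<inter> (ball 0 1 - {0}) \<subseteq> ball 0 1 - {0}" by blast
  then show ?thesis
    unfolding surface_measure_def
    using A assms
    by (simp add: emeasure_distr[OF meas A] space_restrict_space emeasure_restrict_space cone
        sets_restrict_space_iff)
qed

lemma emeasure_surface_measure_sphere:
  "emeasure surface_measure (sphere (0::'a::euclidean_space) 1) =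
     of_nat DIM('a) * emeasure lborel (ball (0::'a) 1)"
proof -
  have eq: "{r *\<^sub>R y | r y. 0 < r \<and> r < 1 \<and> y \<in> sphere (0::'a) 1} = ball 0 1 - {0}" (is "?L = ?R")
  proof (intro equalityI subsetI)
    fix x assume x: "x \<in> ?R"
    then have "x = norm x *\<^sub>R sgn x" "0 < norm x" "norm x < 1" "sgn x \<in> sphere 0 1"
      by (auto simp: sgn_div_norm)
    then show "x \<in> ?L" by blast
  qed auto
  have "emeasure lborel (ball (0::'a) 1 - {0}) = emeasure lborel (ball (0::'a) 1)"
    by (rule emeasure_Diff_null_set) auto
  then show ?thesis
    by (simp only: emeasure_surface_measure[OF borel_closed[OF closed_sphere] order_refl] eq)
qed

definition mobius :: "'a::euclidean_space \<Rightarrow> 'a \<Rightarrow> 'a" where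
  "mobius x y =
     ((1 + 2 * (x \<bullet> y) + (norm y)\<^sup>2) *\<^sub>R x + (1 - (norm x)\<^sup>2) *\<^sub>R y) /\<^sub>R
       (1 + 2 * (x \<bullet> y) + (norm x)\<^sup>2 * (norm y)\<^sup>2)"

text \<open>On the relevant domain no division by zero occurs.\<close>

lemma mobius_denominator_pos:
  fixes x y :: "'a::euclidean_space"
  assumes "norm x < 1" "norm y \<le> 1"
  shows "1 + 2 * (x \<bullet> y) + (norm x)\<^sup>2 * (norm y)\<^sup>2 > 0"
proof -
  have "norm x * norm y < 1"
    using assms by (smt (verit) mult_left_le norm_ge_zero)
  then have "(1 - norm x * norm y)\<^sup>2 > 0" by simp
  moreover have "- (norm x * norm y) \<le> x \<bullet> y"
    using Cauchy_Schwarz_ineq2[of x y] by linarith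
  ultimately show ?thesis by (simp add: power2_eq_square algebra_simps)
qed

end

theory Submission
  imports Defs
begin

text \<open>
  A point \<open>x\<close> of the ball is represented by \<open>p = 2 x / (1 - |x|\<^sup>2)\<close>, that is, by the point
  \<open>(h, p)\<close>, \<open>h = sqrt (1 + |p|\<^sup>2)\<close>, of the hyperboloid. With \<open>\<nu> = f dS\<close>, the integral of
  \<open>T\<^sub>x\<close> vanishes exactly at the critical points of the Busemann potential
  \<open>\<Phi> p = \<integral> ln (h + p \<bullet> y) d\<nu>(y)\<close>. If the hyperboloid is moved by the Lorentz boost taking its
  apex to \<open>p\<close>, then \<open>\<Phi>\<close> changes by a constant and \<open>y\<close> is replaced by \<open>T\<^sub>x y\<close>, so only the behaviour
  around the apex matters. The potential tends to infinity since \<open>\<nu>\<close> has no atoms, hence it has a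
  minimum. A critical point is a strict global minimum, hence unique: along the geodesic of direction
  \<open>u\<close> the integrand is \<open>ln (cosh d + s sinh d)\<close> with \<open>s = u \<bullet> T\<^sub>x y\<close>, which is strictly concave
  in \<open>s\<close> and so exceeds the chord \<open>s d\<close>, whose integral is zero.
\<close>

section \<open>Boosts of the hyperboloid\<close>

definition hgt :: "'a::real_inner \<Rightarrow> real" where
  "hgt p = sqrt (1 + (norm p)\<^sup>2)"

definition boost :: "'a::real_inner \<Rightarrow> 'a \<Rightarrow> 'a" where
  "boost p v = v + (hgt v + (v \<bullet> p) / (1 + hgt p)) *\<^sub>R p"

definition sphere_boost :: "'a::real_inner \<Rightarrow> 'a \<Rightarrow> 'a" where
  "sphere_boost p y = (y + (1 + (p \<bullet> y) / (1 + hgt p)) *\<^sub>R p) /\<^sub>R (hgt p + p \<bullet> y)"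

text \<open>
  \<^term>\<open>boost p\<close> is the Lorentz boost taking the apex to \<open>(hgt p, p)\<close>, restricted to the hyperboloid
  and written in its last coordinates; \<^term>\<open>sphere_boost p\<close> is the action of the same boost on the
  light rays \<open>(1, y)\<close>.
\<close>

lemma hgt_zero [simp]: "hgt 0 = 1"
  by (simp add: hgt_def)

lemma hgt_minus [simp]: "hgt (- p) = hgt p"
  by (simp add: hgt_def)

lemma isCont_hgt: "isCont hgt p"
  unfolding hgt_def[abs_def] by (intro continuous_intros)

lemma hgt_sq: "(hgt p)\<^sup>2 = 1 + p \<bullet> p"
  by (simp add: hgt_def power2_norm_eq_inner)

lemma hgt_ge_1: "hgt p \<ge> 1"
  by (simp add: hgt_def)

lemma hgt_pos [simp]: "hgt p > 0"
  using hgt_ge_1[of p] by linarith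

lemma norm_less_hgt: "norm p < hgt p"
  unfolding hgt_def by (rule real_less_rsqrt) simp

text \<open>With \<open>d\<close> the hyperbolic distance from the apex, \<open>hgt p\<close> is
  cosh d and \<open>norm p\<close> is sinh d. Thus \<open>hgt p + norm p\<close> is exp d, and its
  logarithm, which recurs below, is this distance.\<close>

lemma hgt_diff_norm: "hgt p - norm p = inverse (hgt p + norm p)"
proof -
  have "(hgt p - norm p) * (hgt p + norm p) = 1"
    by (simp add: algebra_simps hgt_sq[unfolded power2_eq_square] dot_square_norm power2_eq_square)
  then show ?thesis
    by (metis inverse_unique mult.commute)
qed

lemma hgt_le: "hgt p \<le> 1 + (norm p)\<^sup>2 / 2"
  unfolding hgt_def by (rule real_le_lsqrt) (auto simp: power2_eq_square algebra_simps)

lemma hgt_le_norm: "hgt p \<le> 1 + norm p"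
  unfolding hgt_def by (rule real_le_lsqrt) (auto simp: power2_eq_square algebra_simps)

lemma hgt_inner_ge:
  assumes "norm y = 1"
  shows "hgt p - norm p \<le> hgt p + p \<bullet> y" "hgt p + p \<bullet> y \<le> hgt p + norm p"
  using Cauchy_Schwarz_ineq2[of p y] assms by auto

lemma hgt_inner_pos:
  assumes "norm y = 1"
  shows "hgt p + p \<bullet> y > 0"
  using hgt_inner_ge(1)[OF assms, of p] norm_less_hgt[of p] by linarith

lemma hgt_unique:
  assumes "a\<^sup>2 = 1 + p \<bullet> p" "a \<ge> 0"
  shows "hgt p = a"
  using assms hgt_sq[of p] hgt_pos[of p] by (metis less_imp_le power2_eq_imp_eq)

lemma boost_zero [simp]: "boost p 0 = p"
  by (simp add: boost_def)

text \<open>The right side is the time coordinate of the boosted point. The boost preserves the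
  Lorentz norm, and Cauchy-Schwarz with \<open>norm_less_hgt\<close> gives the sign of the
  root.\<close>

lemma hgt_boost: "hgt (boost p v) = hgt v * hgt p + v \<bullet> p"
proof (rule hgt_unique)
  define h k s where "h = hgt p" "k = hgt v" "s = v \<bullet> p"
  note defs = this
  have h: "p \<bullet> p = h\<^sup>2 - 1" "v \<bullet> v = k\<^sup>2 - 1" "1 + h \<noteq> 0"
    using hgt_sq[of p] hgt_sq[of v] hgt_ge_1[of p] by (auto simp: defs)
  \<comment> \<open>The coefficient of \<open>p\<close> in \<open>boost p v\<close>. Expressing
    \<open>s\<close> through \<open>c\<close> removes the division and leaves a polynomial
    identity.\<close>
  define c where "c = k + s / (1 + h)"
  have c: "s = (c - k) * (1 + h)"
    using h by (simp add: c_def)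
  have "boost p v \<bullet> boost p v = v \<bullet> v + 2 * c * s + c\<^sup>2 * (p \<bullet> p)"
    by (simp add: boost_def c_def defs inner_add_left inner_add_right inner_commute power2_eq_square)
  also have "\<dots> = k\<^sup>2 - 1 + 2 * c * s + c\<^sup>2 * (h\<^sup>2 - 1)"
    by (simp add: h)
  also have "\<dots> = (k * h + s)\<^sup>2 - 1"
    unfolding c by (simp add: power2_eq_square algebra_simps)
  finally show "(hgt v * hgt p + v \<bullet> p)\<^sup>2 = 1 + boost p v \<bullet> boost p v"
    by (simp add: defs)
  have "norm v * norm p \<le> hgt v * hgt p"
    by (intro mult_mono less_imp_le[OF norm_less_hgt]) (auto simp: less_imp_le)
  then show "hgt v * hgt p + v \<bullet> p \<ge> 0"
    using Cauchy_Schwarz_ineq2[of v p] by linarith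
qed

text \<open>Opposite boosts are inverse to each other. Hence every \<open>q\<close> has the form
  \<open>boost p v\<close>, which lets any statement about \<open>q\<close> relative to
  \<open>p\<close> be read at the apex.\<close>

lemma boost_boost_minus: "boost p (boost (- p) q) = q"
proof -
  define h k s where "h = hgt p" "k = hgt q" "s = q \<bullet> p"
  note defs = this
  have h: "p \<bullet> p = h\<^sup>2 - 1" "1 + h \<noteq> 0"
    using hgt_sq[of p] hgt_ge_1[of p] by (auto simp: defs)
  \<comment> \<open>The first boost subtracts \<open>c *\<^sub>R p\<close>; the second turns out to
    add \<open>p\<close> with the same coefficient.\<close>
  define c where "c = k - s / (1 + h)"
  have c: "s = (k - c) * (1 + h)"
    using h by (simp add: c_def)
  have v: "boost (- p) q = q - c *\<^sub>R p"
    by (simp add: boost_def c_def defs)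
  have hv: "hgt (q - c *\<^sub>R p) = k * h - s"
    using hgt_boost[of "- p" q] by (simp add: v defs)
  have vp: "(q - c *\<^sub>R p) \<bullet> p = s - c * (h\<^sup>2 - 1)"
    by (simp add: inner_diff_left h) (simp add: defs)
  have "k * h - s + (s - c * (h\<^sup>2 - 1)) / (1 + h) = c"
  proof -
    have "s - c * (h\<^sup>2 - 1) = (k - c * h) * (1 + h)"
      by (simp add: c power2_eq_square algebra_simps)
    then have "(s - c * (h\<^sup>2 - 1)) / (1 + h) = k - c * h"
      using h by simp
    then show ?thesis
      by (simp add: c algebra_simps)
  qed
  then show ?thesis
    unfolding v boost_def[of p] hv vp defs(1)[symmetric] by simp
qed

lemma sphere_boost_scaled:
  assumes "norm y = 1"
  shows "(hgt p + p \<bullet> y) *\<^sub>R sphere_boost p y = y + (1 + (p \<bullet> y) / (1 + hgt p)) *\<^sub>R p"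
  using hgt_inner_pos[OF assms, of p] by (simp add: sphere_boost_def)

text \<open>Invariance of the Lorentz product under a boost, in the form of a cocycle relation.\<close>

lemma hgt_boost_inner:
  assumes "norm y = 1"
  shows "hgt (boost p v) + boost p v \<bullet> y = (hgt p + p \<bullet> y) * (hgt v + v \<bullet> sphere_boost p y)"
proof -
  have "(hgt p + p \<bullet> y) * (hgt v + v \<bullet> sphere_boost p y)
      = (hgt p + p \<bullet> y) * hgt v + v \<bullet> ((hgt p + p \<bullet> y) *\<^sub>R sphere_boost p y)"
    by (simp add: distrib_left)
  then show ?thesis
    unfolding sphere_boost_scaled[OF assms] hgt_boost
    by (simp add: boost_def inner_add_left inner_add_right algebra_simps)
qed

text \<open>The boost sends \<open>(1, y)\<close> to \<open>hgt p + p \<bullet> y\<close> times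
  \<open>(1, sphere_boost p y)\<close>. The second factor here is the scaling of the inverse boost,
  so the two are reciprocal.\<close>

lemma sphere_boost_inner:
  assumes "norm y = 1"
  shows "(hgt p + p \<bullet> y) * (hgt p - p \<bullet> sphere_boost p y) = 1"
proof -
  define h s where "h = hgt p" "s = p \<bullet> y"
  note defs = this
  have h: "p \<bullet> p = h\<^sup>2 - 1" "1 + h \<noteq> 0"
    using hgt_sq[of p] hgt_ge_1[of p] by (auto simp: defs)
  have "(hgt p + p \<bullet> y) * (hgt p - p \<bullet> sphere_boost p y)
      = (hgt p + p \<bullet> y) * hgt p - p \<bullet> ((hgt p + p \<bullet> y) *\<^sub>R sphere_boost p y)"
    by (simp add: right_diff_distrib)
  also have "\<dots> = (h + s) * h - (s + (1 + s / (1 + h)) * (h\<^sup>2 - 1))"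
    unfolding sphere_boost_scaled[OF assms] by (simp add: inner_add_right defs hgt_sq)
  also have "(1 + s / (1 + h)) * (h\<^sup>2 - 1) = (1 + h + s) * (h - 1)"
    using h(2) by (simp add: field_simps power2_eq_square)
  finally show ?thesis
    by (simp add: algebra_simps)
qed

text \<open>The boost preserves the light cone: the numerator in \<open>sphere_boost\<close> has
  norm equal to its time coordinate \<open>hgt p + p \<bullet> y\<close>.\<close>

lemma norm_sphere_boost:
  assumes "norm y = 1"
  shows "norm (sphere_boost p y) = 1"
proof -
  define h s where "h = hgt p" "s = p \<bullet> y"
  note defs = this
  have h: "p \<bullet> p = h\<^sup>2 - 1" "1 + h \<noteq> 0" "h + s > 0" "y \<bullet> y = 1"
    using hgt_sq[of p] hgt_ge_1[of p] hgt_inner_pos[OF assms, of p] assms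
    by (auto simp: defs dot_square_norm)
  define c where "c = 1 + s / (1 + h)"
  have c: "s = (c - 1) * (1 + h)"
    using h by (simp add: c_def)
  have "(norm (y + c *\<^sub>R p))\<^sup>2 = y \<bullet> y + 2 * c * s + c\<^sup>2 * (p \<bullet> p)"
    unfolding power2_norm_eq_inner
    by (simp add: defs inner_add_left inner_add_right inner_commute power2_eq_square)
  also have "\<dots> = (h + s)\<^sup>2"
    unfolding h by (simp add: c power2_eq_square algebra_simps)
  finally have "norm (y + c *\<^sub>R p) = h + s"
    using h by (simp add: power2_eq_iff_nonneg)
  then show ?thesis
    using h by (simp add: sphere_boost_def c_def defs)
qed

text \<open>By \<open>sphere_boost_inner\<close> the scaling factor can be read off from the image;
  once the factors agree, so do the translations by multiples of \<open>p\<close>.\<close>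

lemma sphere_boost_inj:
  assumes "norm y = 1" "norm z = 1" "sphere_boost p y = sphere_boost p z"
  shows "y = z"
proof -
  have eq: "hgt p + p \<bullet> y = hgt p + p \<bullet> z"
    by (rule inverse_eq_imp_eq)
      (simp only: inverse_unique[OF sphere_boost_inner] assms)
  have "y + (1 + (p \<bullet> y) / (1 + hgt p)) *\<^sub>R p = z + (1 + (p \<bullet> z) / (1 + hgt p)) *\<^sub>R p"
    unfolding sphere_boost_scaled[symmetric, OF assms(1)] sphere_boost_scaled[symmetric, OF assms(2)]
    by (simp only: eq assms(3))
  then show ?thesis
    using eq by simp
qed

section \<open>The ball model and the hyperboloid\<close>

text \<open>Here \<open>x\<close> is the stereographic image of \<open>(hgt p, p)\<close> in the
  Poincare ball, with \<open>hgt p\<close> equal to (1 + |x|^2) / (1 - |x|^2).\<close>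

lemma mobius_eq_sphere_boost:
  fixes x y :: "'a::euclidean_space"
  assumes "norm x < 1" "norm y = 1"
  defines "p \<equiv> (2 / (1 - (norm x)\<^sup>2)) *\<^sub>R x"
  shows "mobius x y = sphere_boost p y" "x = p /\<^sub>R (1 + hgt p)"
proof -
  define r where "r = 1 - (norm x)\<^sup>2"
  have r: "r > 0" "(norm x)\<^sup>2 = 1 - r" "x \<bullet> x = 1 - r" "r \<le> 1"
    using assms by (auto simp: r_def power2_norm_eq_inner[symmetric] abs_square_less_1)
  have p: "p = (2 / r) *\<^sub>R x"
    by (simp add: p_def r_def)
  have h: "hgt p = (2 - r) / r"
    by (rule hgt_unique) (use r in \<open>auto simp: p field_simps power2_eq_square\<close>)
  have h1: "1 + hgt p = 2 / r"
    using r by (simp add: h field_simps)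
  show "x = p /\<^sub>R (1 + hgt p)"
    unfolding h1 using r by (simp add: p)
  define d where "d = 2 - r + 2 * (x \<bullet> y)"
  have "hgt p + p \<bullet> y = d / r"
    using r by (simp add: h d_def add_divide_distrib) (simp add: p)
  moreover have "1 + (p \<bullet> y) / (1 + hgt p) = 1 + x \<bullet> y"
    unfolding h1 using r by (simp add: p)
  ultimately have "sphere_boost p y = (r / d) *\<^sub>R (y + (1 + x \<bullet> y) *\<^sub>R (2 / r) *\<^sub>R x)"
    unfolding sphere_boost_def p by simp
  also have "\<dots> = (1 / d) *\<^sub>R (r *\<^sub>R y + (2 * (1 + x \<bullet> y)) *\<^sub>R x)"
    using r by (simp add: scaleR_add_right mult.commute)
  also have "\<dots> = mobius x y"
  proof -
    have "1 + 2 * (x \<bullet> y) + (norm x)\<^sup>2 * (norm y)\<^sup>2 = d"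
      "1 + 2 * (x \<bullet> y) + (norm y)\<^sup>2 = 2 * (1 + x \<bullet> y)"
      using r assms(2) by (auto simp: d_def)
    then show ?thesis
      unfolding mobius_def r_def[symmetric] by (simp add: divide_inverse add.commute)
  qed
  finally show "mobius x y = sphere_boost p y" ..
qed

text \<open>The converse direction: together with the preceding lemma it makes \<open>x\<close> and
  \<open>p\<close> correspond bijectively.\<close>

lemma ball_hyperboloid:
  fixes p :: "'a::euclidean_space"
  defines "x \<equiv> p /\<^sub>R (1 + hgt p)"
  shows "norm x < 1" "(2 / (1 - (norm x)\<^sup>2)) *\<^sub>R x = p"
proof -
  have h: "1 + hgt p > 0"
    using hgt_ge_1[of p] by linarith
  show "norm x < 1"
    using norm_less_hgt[of p] h by (simp add: x_def divide_inverse[symmetric] field_simps)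
  have "(norm x)\<^sup>2 = ((hgt p)\<^sup>2 - 1) / (1 + hgt p)\<^sup>2"
    using h by (simp add: x_def hgt_sq power_mult_distrib power2_norm_eq_inner[symmetric] field_simps)
  also have "\<dots> = (hgt p - 1) / (1 + hgt p)"
  proof -
    have "(hgt p)\<^sup>2 - 1 = (hgt p - 1) * (1 + hgt p)"
      by (simp add: algebra_simps power2_eq_square)
    then show ?thesis
      using h by (simp add: power2_eq_square)
  qed
  finally have "1 - (norm x)\<^sup>2 = 2 / (1 + hgt p)"
    using h by (simp add: field_simps)
  then show "(2 / (1 - (norm x)\<^sup>2)) *\<^sub>R x = p"
    using h by (simp only:) (simp add: x_def field_simps)
qed

section \<open>Logarithmic inequalities along a geodesic\<close>

text \<open>Strict concavity of \<open>ln\<close> between \<open>inverse A\<close> and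
  \<open>A\<close>. With \<open>m\<close> the weighted mean, apply ln t \<le> t - 1 at t = A / m and
  t = inverse A / m; the weighted right sides cancel.\<close>

lemma ln_chord_less:
  fixes A s :: real
  assumes "A > 1" "\<bar>s\<bar> < 1"
  shows "s * ln A < ln ((1 + s) / 2 * A + (1 - s) / 2 * inverse A)"
proof -
  define m where "m = (1 + s) / 2 * A + (1 - s) / 2 * inverse A"
  have s: "(1 + s) / 2 > 0" "(1 - s) / 2 > 0" "inverse A > 0" "inverse A < A"
    using assms less_trans[OF inverse_less_1_iff[THEN iffD2] assms(1)] by auto
  have m: "m > 0"
    unfolding m_def using s assms by (intro add_pos_pos mult_pos_pos) auto
  \<comment> \<open>This difference is positive as \<open>s < 1\<close>, which makes the bound at
    \<open>A / m\<close> strict.\<close>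
  have "A - m = (1 - s) / 2 * (A - inverse A)"
    by (simp add: m_def add_divide_distrib diff_divide_distrib algebra_simps)
  then have "A / m \<noteq> 1"
    using s by auto
  then have 1: "ln A - ln m < A / m - 1"
    using ln_le_minus_one[of "A / m"] ln_eq_minus_one[of "A / m"] m assms
    by (auto simp: ln_div less_le)
  have 2: "ln (inverse A) - ln m \<le> inverse A / m - 1"
    using ln_le_minus_one[of "inverse A / m"] m s assms by (simp add: ln_div)
  have "(1 + s) / 2 * (ln A - ln m) + (1 - s) / 2 * (ln (inverse A) - ln m)
      < (1 + s) / 2 * (A / m - 1) + (1 - s) / 2 * (inverse A / m - 1)"
    using s by (intro add_less_le_mono mult_strict_left_mono mult_left_mono 1 2) auto
  also have "\<dots> = ((1 + s) / 2 * A + (1 - s) / 2 * inverse A) / m - 1"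
    by (simp add: add_divide_distrib diff_divide_distrib algebra_simps)
  also have "\<dots> = m / m - 1"
    by (simp only: m_def)
  finally have "s * ln A < ln m"
    using m by (simp add: ln_inverse add_divide_distrib diff_divide_distrib algebra_simps)
  then show ?thesis
    by (simp only: m_def)
qed

text \<open>Apply \<open>ln_chord_less\<close> with \<open>A = hgt v + norm v\<close> and
  \<open>s = sgn v \<bullet> T\<close>. Excluding the two endpoints of the geodesic excludes
  equality in Cauchy-Schwarz, so \<bar>s\<bar> < 1.\<close>

lemma ln_boost_chord_less:
  assumes "norm T = 1" "T \<noteq> sgn v" "T \<noteq> - sgn v" "v \<noteq> 0"
  shows "(sgn v \<bullet> T) * ln (hgt v + norm v) < ln (hgt v + v \<bullet> T)"
proof -
  define s where "s = sgn v \<bullet> T"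
  have v: "v \<bullet> T = norm v * s"
    using assms(4) by (simp add: s_def sgn_div_norm)
  have n: "sgn v \<bullet> sgn v = 1" "T \<bullet> T = 1"
    using assms by (auto simp: dot_square_norm norm_sgn)
  have "0 < (T - sgn v) \<bullet> (T - sgn v)" "0 < (T + sgn v) \<bullet> (T + sgn v)"
    using assms by (auto simp: eq_neg_iff_add_eq_0)
  then have "\<bar>s\<bar> < 1"
    by (simp add: inner_diff_left inner_diff_right inner_add_left inner_add_right n s_def inner_commute)
  moreover have "hgt v + norm v > 1"
    using hgt_ge_1[of v] assms by (smt (verit) zero_less_norm_iff)
  ultimately have "s * ln (hgt v + norm v) <
      ln ((1 + s) / 2 * (hgt v + norm v) + (1 - s) / 2 * (hgt v - norm v))"
    unfolding hgt_diff_norm by (rule ln_chord_less[rotated])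
  also have "(1 + s) / 2 * (hgt v + norm v) + (1 - s) / 2 * (hgt v - norm v) = hgt v + v \<bullet> T"
    by (simp add: v field_simps)
  finally show ?thesis
    by (simp add: s_def)
qed

text \<open>The bound does not depend on \<open>y\<close>: it yields integrability over a finite
  measure, and later continuity of the potential.\<close>

lemma abs_ln_hgt_inner_le:
  assumes "norm y = 1"
  shows "\<bar>ln (hgt p + p \<bullet> y)\<bar> \<le> ln (hgt p + norm p)"
proof -
  have pos: "hgt p + norm p > 0"
    using hgt_pos[of p] norm_ge_zero[of p] by linarith
  have "inverse (hgt p + norm p) \<le> hgt p + p \<bullet> y"
    using hgt_inner_ge(1)[OF assms, of p] by (simp add: hgt_diff_norm)
  then have "ln (inverse (hgt p + norm p)) \<le> ln (hgt p + p \<bullet> y)"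
    using pos hgt_inner_pos[OF assms, of p] by simp
  moreover have "ln (hgt p + p \<bullet> y) \<le> ln (hgt p + norm p)"
    using hgt_inner_ge(2)[OF assms, of p] hgt_inner_pos[OF assms, of p] pos by simp
  ultimately show ?thesis
    using pos by (simp add: ln_inverse abs_le_iff)
qed

section \<open>The potential of a diffuse measure on the sphere\<close>

locale diffuse_sphere_measure = finite_measure \<nu>
  for \<nu> :: "'a::euclidean_space measure" +
  assumes space_sphere: "space \<nu> = sphere 0 1"
    and measurable_ident [measurable]: "(\<lambda>y. y) \<in> borel_measurable \<nu>"
    and diffuse: "\<And>a. AE y in \<nu>. y \<noteq> a"
    and nontrivial: "measure \<nu> (space \<nu>) > 0"
begin

definition potential :: "'a \<Rightarrow> real" where
  "potential p = (\<integral>y. ln (hgt p + p \<bullet> y) \<partial>\<nu>)"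

lemma norm_space: "y \<in> space \<nu> \<Longrightarrow> norm y = 1"
  by (simp add: space_sphere)

lemma norm_sphere_boost_space: "y \<in> space \<nu> \<Longrightarrow> norm (sphere_boost p y) = 1"
  by (intro norm_sphere_boost norm_space)

lemma measurable_sphere_boost [measurable]: "sphere_boost p \<in> borel_measurable \<nu>"
  unfolding sphere_boost_def[abs_def] by measurable

lemma integrable_sphere_boost [simp]: "integrable \<nu> (sphere_boost p)"
  by (rule integrable_const_bound[where B = 1]) (auto intro!: AE_I2 simp: norm_sphere_boost_space)

lemma integrable_ln_hgt [simp]: "integrable \<nu> (\<lambda>y. ln (hgt p + p \<bullet> y))"
  by (rule integrable_const_bound[where B = "ln (hgt p + norm p)"])
    (auto intro!: AE_I2 abs_ln_hgt_inner_le norm_space)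

lemma integrable_ln_hgt_sphere_boost [simp]:
  "integrable \<nu> (\<lambda>y. ln (hgt v + v \<bullet> sphere_boost p y))"
  by (rule integrable_const_bound[where B = "ln (hgt v + norm v)"])
    (auto intro!: AE_I2 abs_ln_hgt_inner_le norm_sphere_boost_space)

text \<open>The logarithm turns the cocycle relation \<open>hgt_boost_inner\<close> into a sum. The
  new integral is the potential at \<open>v\<close> of the measure transported by
  \<open>sphere_boost p\<close>.\<close>

lemma potential_boost:
  "potential (boost p v) = potential p + (\<integral>y. ln (hgt v + v \<bullet> sphere_boost p y) \<partial>\<nu>)"
proof -
  have "potential (boost p v) =
      (\<integral>y. ln (hgt p + p \<bullet> y) + ln (hgt v + v \<bullet> sphere_boost p y) \<partial>\<nu>)"
    unfolding potential_def
  proof (rule Bochner_Integration.integral_cong)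
    fix y assume "y \<in> space \<nu>"
    then have y: "norm y = 1"
      by (rule norm_space)
    show "ln (hgt (boost p v) + boost p v \<bullet> y) =
        ln (hgt p + p \<bullet> y) + ln (hgt v + v \<bullet> sphere_boost p y)"
      unfolding hgt_boost_inner[OF y]
      using hgt_inner_pos[OF y, of p] hgt_inner_pos[OF norm_sphere_boost[OF y, of p], of v]
      by (simp add: ln_mult)
  qed simp
  then show ?thesis
    by (simp add: potential_def)
qed

lemma continuous_potential: "continuous_on UNIV potential"
proof (rule continuous_at_imp_continuous_on, intro ballI)
  fix p :: 'a
  \<comment> \<open>The position of \<open>q\<close> once \<open>p\<close> is moved to the apex. The
    bound below is a Lipschitz estimate in hyperbolic distance.\<close>
  define v where "v q = boost (- p) q" for q
  have "boost (- p) (boost (- (- p)) 0) = 0"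
    by (rule boost_boost_minus)
  then have v0: "v p = 0"
    by (simp add: v_def)
  have bound: "norm (potential q - potential p) \<le>
      measure \<nu> (space \<nu>) * ln (hgt (v q) + norm (v q))" for q
  proof -
    have "potential q - potential p = (\<integral>y. ln (hgt (v q) + v q \<bullet> sphere_boost p y) \<partial>\<nu>)"
      using potential_boost[of p "v q"] by (simp add: v_def boost_boost_minus)
    also have "norm \<dots> \<le> (\<integral>y. norm (ln (hgt (v q) + v q \<bullet> sphere_boost p y)) \<partial>\<nu>)"
      by (rule Bochner_Integration.integral_norm_bound)
    also have "\<dots> \<le> (\<integral>y. ln (hgt (v q) + norm (v q)) \<partial>\<nu>)"
      by (rule integral_mono) (auto intro!: abs_ln_hgt_inner_le norm_sphere_boost_space)
    finally show ?thesis
      by simp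
  qed
  have "hgt (- p) + 1 \<noteq> 0"
    using hgt_pos[of "- p"] by linarith
  then have "isCont v p"
    unfolding v_def boost_def by (intro continuous_intros isCont_hgt) (simp add: add.commute)
  then have v: "(v \<longlongrightarrow> 0) (at p)"
    by (simp add: isCont_def v0)
  have "((\<lambda>q. ln (hgt (v q) + norm (v q))) \<longlongrightarrow> ln (hgt (0::'a) + norm (0::'a))) (at p)"
    by (intro tendsto_ln tendsto_add isCont_tendsto_compose[OF isCont_hgt] tendsto_norm v) simp
  then have "((\<lambda>q. measure \<nu> (space \<nu>) * ln (hgt (v q) + norm (v q))) \<longlongrightarrow> 0) (at p)"
    by (intro tendsto_mult_right_zero) simp
  then have "((\<lambda>q. potential q - potential p) \<longlongrightarrow> 0) (at p)"
    by (rule Lim_null_comparison[rotated]) (use bound in simp)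
  then show "isCont potential p"
    by (simp add: isCont_def LIM_zero_iff)
qed

section \<open>Concentration of mass and growth at infinity\<close>

text \<open>Continuity from above: balls shrinking to \<open>a\<close> have measure tending to that
  of a null set.\<close>

lemma small_neighbourhood:
  assumes "a \<in> sphere 0 1" "c > 0"
  obtains r where "r > 0" "measure \<nu> (ball a r \<inter> sphere 0 1) < c"
proof -
  define A where "A n = ball a (inverse (real (Suc n))) \<inter> sphere 0 1" for n
  have sets: "range A \<subseteq> sets \<nu>"
    using measurable_sets[OF measurable_ident borel_open[OF open_ball]]
    by (auto simp: A_def space_sphere)
  have "decseq A"
    unfolding A_def decseq_def
    by (intro allI impI Int_mono subset_ball le_imp_inverse_le) auto
  then have lim: "(\<lambda>n. measure \<nu> (A n)) \<longlonglongrightarrow> measure \<nu> (\<Inter>n. A n)"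
    using sets by (intro finite_Lim_measure_decseq)
  have "(\<Inter>n. A n) \<subseteq> {a}"
  proof
    fix y assume y: "y \<in> (\<Inter>n. A n)"
    then have "dist a y < inverse (real (Suc n))" for n
      by (auto simp: A_def)
    then show "y \<in> {a}"
      using reals_Archimedean[of "dist a y"] by (metis dist_pos_lt less_asym singletonI)
  qed
  moreover have "{a} \<in> null_sets \<nu>"
  proof -
    have "{y \<in> space \<nu>. \<not> y \<noteq> a} = {a}"
      using assms by (auto simp: space_sphere)
    moreover have "{a} \<in> sets \<nu>"
      using measurable_sets[OF measurable_ident, of "{a}"] assms by (simp add: space_sphere)
    ultimately show ?thesis
      using diffuse[of a] AE_iff_null[of \<nu> "\<lambda>y. y \<noteq> a"] by simp
  qed
  moreover have "(\<Inter>n. A n) \<in> sets \<nu>"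
    using sets by (intro sets.countable_INT) auto
  ultimately have "measure \<nu> (\<Inter>n. A n) = 0"
    using null_sets_subset measure_eq_0_null_sets by blast
  with lim assms(2) have "eventually (\<lambda>n. measure \<nu> (A n) < c) sequentially"
    by (intro order_tendstoD(2)) auto
  then obtain n where "measure \<nu> (A n) < c"
    using eventually_happens'[OF sequentially_bot] by blast
  then show ?thesis
    by (intro that[of "inverse (real (Suc n))"]) (auto simp: A_def)
qed

text \<open>The radius is a Lebesgue number of the cover of the compact sphere by open sets of small
  mass.\<close>

lemma uniform_small_balls:
  assumes "c > 0"
  obtains r where "r > 0" "\<And>a. a \<in> sphere 0 1 \<Longrightarrow> measure \<nu> (ball a r \<inter> sphere 0 1) < c"
proof -
  define G where "G = {U. open U \<and> measure \<nu> (U \<inter> sphere 0 1) < c}"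
  have "sphere 0 1 \<subseteq> \<Union>G"
  proof
    fix a :: 'a assume "a \<in> sphere 0 1"
    then obtain r where "r > 0" "measure \<nu> (ball a r \<inter> sphere 0 1) < c"
      using small_neighbourhood assms by blast
    then show "a \<in> \<Union>G"
      by (auto simp: G_def intro!: exI[of _ "ball a r"])
  qed
  then obtain r where r: "r > 0" "\<And>a. a \<in> sphere 0 1 \<Longrightarrow> \<exists>U\<in>G. ball a r \<subseteq> U"
    by (rule Heine_Borel_lemma[OF compact_sphere]) (auto simp: G_def)
  show ?thesis
  proof (rule that[OF r(1)])
    fix a :: 'a assume "a \<in> sphere 0 1"
    then obtain U where U: "open U" "measure \<nu> (U \<inter> sphere 0 1) < c" "ball a r \<subseteq> U"
      using r(2) by (auto simp: G_def)
    have "measure \<nu> (ball a r \<inter> sphere 0 1) \<le> measure \<nu> (U \<inter> sphere 0 1)"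
      using U measurable_sets[OF measurable_ident borel_open[OF U(1)]]
      by (intro finite_measure_mono) (auto simp: space_sphere)
    with U show "measure \<nu> (ball a r \<inter> sphere 0 1) < c"
      by linarith
  qed
qed

text \<open>The integrand is at least \<open>- K\<close> near \<open>- sgn p\<close>, on a set of
  mass below \<open>M / 4\<close>, and at least \<open>L\<close> elsewhere. Since
  \<open>K < 3 * L\<close>, the larger part wins.\<close>

lemma potential_coercive:
  obtains R where "\<And>p. norm p \<ge> R \<Longrightarrow> potential p > 0"
proof -
  define M where "M = measure \<nu> (space \<nu>)"
  have M: "M > 0"
    using nontrivial by (simp add: M_def)
  obtain r where r: "r > 0" "\<And>a. a \<in> sphere 0 1 \<Longrightarrow> measure \<nu> (ball a r \<inter> sphere 0 1) < M / 4"
    using uniform_small_balls[of "M / 4"] M by auto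
  \<comment> \<open>Off the ball of radius \<open>r\<close> about \<open>- sgn p\<close> one has
    \<open>1 + sgn p \<bullet> y \<ge> r\<^sup>2 / 2\<close>. The cap at 1 gives
    \<open>R * d\<^sup>2 \<le> R * d \<le> R\<close>.\<close>
  define d where "d = min 1 (r\<^sup>2 / 2)"
  have d: "0 < d" "d \<le> 1" "d \<le> r\<^sup>2 / 2"
    using r by (auto simp: d_def)
  \<comment> \<open>The threshold makes \<open>R * d\<^sup>2\<close> and \<open>R * d\<close> at
    least 3, hence \<open>(R * d) ^ 3 \<ge> 9 * R > 3 * R\<close>, which is
    \<open>K < 3 * L\<close>.\<close>
  show ?thesis
  proof (rule that[of "3 / d\<^sup>2"])
    fix p :: 'a assume p: "norm p \<ge> 3 / d\<^sup>2"
    define R where "R = norm p"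
    define B where "B = ball (- sgn p) r \<inter> sphere 0 1"
    have R2: "R * d\<^sup>2 \<ge> 3"
      using p d by (simp add: R_def field_simps)
    have "R \<ge> 0" by (simp add: R_def)
    have "R * d\<^sup>2 \<le> R * d" "R * d \<le> R"
      using d \<open>R \<ge> 0\<close> by (auto simp: power2_eq_square intro!: mult_left_mono mult_left_le)
    then have R: "R * d \<ge> 3" "R \<ge> 3"
      using R2 by linarith+
    then have "p \<noteq> 0"
      by (auto simp: R_def)
    define L K where "L = ln (R * d)" "K = ln (3 * R)"
    have "L \<ge> 0" "K \<ge> 0"
      using R by (auto simp: L_K_def)
    have "K < 3 * L"
    proof -
      have "3 * R < R * 3 * 3"
        using R by simp
      also have "\<dots> \<le> R * (R * d\<^sup>2) * (R * d)"
        using R R2 by (intro mult_mono) auto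
      also have "\<dots> = (R * d) ^ 3"
        by (simp add: power2_eq_square power3_eq_cube)
      finally have "ln (3 * R) < ln ((R * d) ^ 3)"
        using R by (subst ln_less_cancel_iff) auto
      then show ?thesis
        using R by (simp add: L_K_def ln_realpow)
    qed
    have B: "measure \<nu> B < M / 4"
      using r(2)[of "- sgn p"] \<open>p \<noteq> 0\<close> by (simp add: B_def norm_sgn)
    have Bs [measurable]: "B \<in> sets \<nu>"
      using measurable_sets[OF measurable_ident borel_open[OF open_ball]]
      by (simp add: B_def space_sphere)
    have ind: "integrable \<nu> (\<lambda>y. (L + K) * indicator B y)"
      using Bs by (intro integrable_mult_right integrable_real_indicator) (auto simp: less_top[symmetric])
    have "0 < 3 / 4 * M * L - M / 4 * K"
      using M \<open>K < 3 * L\<close> by (simp add: field_simps)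
    also have "\<dots> = M * L - (L + K) * (M / 4)"
      by (simp add: field_simps)
    also have "\<dots> \<le> M * L - (L + K) * measure \<nu> B"
      using B \<open>L \<ge> 0\<close> \<open>K \<ge> 0\<close> by (intro diff_left_mono mult_left_mono) auto
    also have "\<dots> = (\<integral>y. L - (L + K) * indicator B y \<partial>\<nu>)"
      using ind by (subst Bochner_Integration.integral_diff)
        (auto simp: M_def sets.Int_space_eq2[OF Bs])
    also have "\<dots> \<le> potential p"
      unfolding potential_def
    proof (rule integral_mono)
      show "integrable \<nu> (\<lambda>y. L - (L + K) * indicator B y)"
        using ind by simp
      fix y assume "y \<in> space \<nu>"
      then have y: "norm y = 1"
        by (rule norm_space)
      show "L - (L + K) * indicator B y \<le> ln (hgt p + p \<bullet> y)"
      proof (cases "y \<in> B")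
        case True
        \<comment> \<open>From \<open>hgt_le_norm\<close> the argument is at most
          \<open>1 + 2 * R\<close>, and this is at most \<open>3 * R\<close>.\<close>
        have "ln (hgt p + norm p) \<le> K"
          unfolding L_K_def using hgt_le_norm[of p] R hgt_pos[of p]
          by (subst ln_le_cancel_iff) (auto simp: R_def intro: add_pos_nonneg)
        then show ?thesis
          using abs_ln_hgt_inner_le[OF y, of p] True by simp
      next
        case False
        then have "r \<le> norm (y + sgn p)"
          using y by (simp add: B_def dist_norm norm_minus_commute add.commute)
        then have "r\<^sup>2 \<le> (norm (y + sgn p))\<^sup>2"
          using r by (intro power_mono) auto
        also have "\<dots> = 2 + 2 * (sgn p \<bullet> y)"
        proof -
          have "y \<bullet> y = 1" "sgn p \<bullet> sgn p = 1"
            using y \<open>p \<noteq> 0\<close> by (simp_all add: dot_square_norm norm_sgn)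
          then show ?thesis
            unfolding power2_norm_eq_inner
            by (simp add: inner_add_left inner_add_right inner_commute)
        qed
        finally have "d \<le> 1 + sgn p \<bullet> y"
          using d by linarith
        then have "R * d \<le> R * (1 + sgn p \<bullet> y)"
          using R by (intro mult_left_mono) auto
        also have "\<dots> = norm p + p \<bullet> y"
          using \<open>p \<noteq> 0\<close> by (simp add: R_def sgn_div_norm distrib_left)
        also have "\<dots> \<le> hgt p + p \<bullet> y"
          using norm_less_hgt[of p] by simp
        finally have "L \<le> ln (hgt p + p \<bullet> y)"
          unfolding L_K_def using R by (subst ln_le_cancel_iff) auto
        with False show ?thesis
          by simp
      qed
    qed simp
    finally show "potential p > 0" .
  qed
qed

section \<open>Existence of a critical point\<close>

lemma potential_attains_min: "\<exists>p. \<forall>q. potential p \<le> potential q"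
proof -
  obtain R where R: "\<And>p. norm p \<ge> R \<Longrightarrow> potential p > 0"
    using potential_coercive by blast
  \<comment> \<open>Coercivity leaves the sign of \<open>R\<close> open; the absolute value keeps
    the ball nonempty and puts 0 in it, where the potential vanishes.\<close>
  have "continuous_on (cball 0 \<bar>R\<bar>) potential"
    using continuous_potential continuous_on_subset by blast
  then have "\<exists>p\<in>cball 0 \<bar>R\<bar>. \<forall>q\<in>cball 0 \<bar>R\<bar>. potential p \<le> potential q"
    by (intro continuous_attains_inf) auto
  then obtain p where p: "\<And>q. q \<in> cball 0 \<bar>R\<bar> \<Longrightarrow> potential p \<le> potential q"
    by blast
  have "potential 0 = 0"
    by (simp add: potential_def)
  then have "potential p \<le> 0"
    using p[of 0] by simp
  have "potential p \<le> potential q" for q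
  proof (cases "norm q \<le> \<bar>R\<bar>")
    case True
    then show ?thesis
      by (intro p) simp
  next
    case False
    then have "potential q > 0"
      by (intro R) linarith
    with \<open>potential p \<le> 0\<close> show ?thesis
      by linarith
  qed
  then show ?thesis
    by blast
qed

text \<open>The first variation of the potential at \<open>p\<close> in direction \<open>v\<close> is the \<open>v\<close>-component of the
  integral; one-sided bounds from \<open>ln t \<le> t - 1\<close> replace differentiation under the integral.\<close>

lemma integral_sphere_boost_at_min:
  assumes "\<And>q. potential p \<le> potential q"
  shows "(\<integral>y. sphere_boost p y \<partial>\<nu>) = 0"
proof -
  define M b where "M = measure \<nu> (space \<nu>)" "b = (\<integral>y. sphere_boost p y \<partial>\<nu>)"
  have M: "M > 0"
    using nontrivial by (simp add: M_b_def)
  have var: "0 \<le> M * (norm v)\<^sup>2 / 2 + v \<bullet> b" for v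
  proof -
    have "0 \<le> (\<integral>y. ln (hgt v + v \<bullet> sphere_boost p y) \<partial>\<nu>)"
      using assms[of "boost p v"] by (simp add: potential_boost)
    also have "\<dots> \<le> (\<integral>y. (hgt v - 1) + v \<bullet> sphere_boost p y \<partial>\<nu>)"
    proof (rule integral_mono)
      fix y assume "y \<in> space \<nu>"
      then have "hgt v + v \<bullet> sphere_boost p y > 0"
        by (intro hgt_inner_pos norm_sphere_boost norm_space)
      then show "ln (hgt v + v \<bullet> sphere_boost p y) \<le> (hgt v - 1) + v \<bullet> sphere_boost p y"
        using ln_le_minus_one[of "hgt v + v \<bullet> sphere_boost p y"] by linarith
    qed auto
    also have "\<dots> = M * (hgt v - 1) + v \<bullet> b"
      by (simp add: M_b_def)
    also have "\<dots> \<le> M * ((norm v)\<^sup>2 / 2) + v \<bullet> b"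
      using M hgt_le[of v] by (intro add_right_mono mult_left_mono) auto
    finally show ?thesis
      by simp
  qed
  \<comment> \<open>This \<open>v\<close> minimizes the quadratic lower bound in \<open>var\<close>;
    the minimum is negative unless \<open>b = 0\<close>.\<close>
  have "0 \<le> M * (norm ((- 1 / M) *\<^sub>R b))\<^sup>2 / 2 + ((- 1 / M) *\<^sub>R b) \<bullet> b"
    by (rule var)
  also have "\<dots> = - ((norm b)\<^sup>2 / (2 * M))"
    using M by (simp add: power_mult_distrib power2_norm_eq_inner[symmetric] field_simps
        power2_eq_square)
  finally have "(norm b)\<^sup>2 \<le> 0"
    using M by (simp add: field_simps)
  then show ?thesis
    by (simp add: M_b_def)
qed

section \<open>Uniqueness and return to the ball\<close>

text \<open>With \<open>p\<close> moved to the apex, the chord of \<open>ln_boost_chord_less\<close>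
  is linear in \<open>sphere_boost p y\<close>, so its integral vanishes by hypothesis and the
  excess of \<open>potential q\<close> is positive.\<close>

lemma potential_less:
  assumes "(\<integral>y. sphere_boost p y \<partial>\<nu>) = 0" "p \<noteq> q"
  shows "potential p < potential q"
proof -
  define v where "v = boost (- p) q"
  have q: "q = boost p v"
    by (simp add: v_def boost_boost_minus)
  with assms(2) have "v \<noteq> 0"
    by auto
  \<comment> \<open>By injectivity at most one point of the sphere is sent to \<open>u\<close>, and
    points are null.\<close>
  have avoid: "AE y in \<nu>. sphere_boost p y \<noteq> u" for u
  proof (cases "\<exists>y0. norm y0 = 1 \<and> sphere_boost p y0 = u")
    case True
    then obtain y0 where y0: "norm y0 = 1" "sphere_boost p y0 = u"
      by blast
    show ?thesis
      using AE_space diffuse[of y0]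
    proof eventually_elim
      case (elim y)
      then show ?case
        using sphere_boost_inj[OF norm_space[of y] y0(1), of p] y0(2) by auto
    qed
  next
    case False
    then show ?thesis
      using norm_space by (intro AE_I2) auto
  qed
  have "(\<integral>y. (sgn v \<bullet> sphere_boost p y) * ln (hgt v + norm v) \<partial>\<nu>)
      < (\<integral>y. ln (hgt v + v \<bullet> sphere_boost p y) \<partial>\<nu>)"
  proof (rule integral_less_AE_space)
    show "AE y in \<nu>. (sgn v \<bullet> sphere_boost p y) * ln (hgt v + norm v)
        < ln (hgt v + v \<bullet> sphere_boost p y)"
      using AE_space avoid[of "sgn v"] avoid[of "- sgn v"]
      by eventually_elim
        (intro ln_boost_chord_less norm_sphere_boost norm_space \<open>v \<noteq> 0\<close>)
    show "emeasure \<nu> (space \<nu>) \<noteq> 0"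
      using nontrivial by (auto simp: measure_def)
  qed auto
  then show ?thesis
    using assms(1) by (simp add: q potential_boost)
qed

theorem ex1_conformal_barycenter:
  "\<exists>!x. x \<in> ball 0 1 \<and> (\<integral>y. mobius x y \<partial>\<nu>) = 0"
proof -
  define P :: "'a \<Rightarrow> 'a" where "P x = (2 / (1 - (norm x)\<^sup>2)) *\<^sub>R x" for x
  have mob: "(\<integral>y. mobius x y \<partial>\<nu>) = (\<integral>y. sphere_boost (P x) y \<partial>\<nu>)" if "x \<in> ball 0 1" for x
    using that by (intro Bochner_Integration.integral_cong)
      (auto simp: P_def mobius_eq_sphere_boost norm_space)
  obtain p where "\<And>q. potential p \<le> potential q"
    using potential_attains_min by blast
  then have p: "(\<integral>y. sphere_boost p y \<partial>\<nu>) = 0"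
    by (rule integral_sphere_boost_at_min)
  have x: "p /\<^sub>R (1 + hgt p) \<in> ball 0 1" "P (p /\<^sub>R (1 + hgt p)) = p"
    using ball_hyperboloid[of p] by (simp_all add: P_def)
  show ?thesis
  proof (rule ex1I[of _ "p /\<^sub>R (1 + hgt p)"])
    show "p /\<^sub>R (1 + hgt p) \<in> ball 0 1 \<and> (\<integral>y. mobius (p /\<^sub>R (1 + hgt p)) y \<partial>\<nu>) = 0"
      using x p by (simp add: mob)
    fix z assume z: "z \<in> ball 0 1 \<and> (\<integral>y. mobius z y \<partial>\<nu>) = 0"
    then have "(\<integral>y. sphere_boost (P z) y \<partial>\<nu>) = 0"
      using mob[of z] by metis
    \<comment> \<open>Two distinct critical points would each have strictly smaller potential than
      the other.\<close>
    then have "P z = p"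
      using p potential_less[of p "P z"] potential_less[of "P z" p] by fastforce
    moreover have "z = P z /\<^sub>R (1 + hgt (P z))"
      \<comment> \<open>A basis vector serves as the unit vector that the cited lemma asks
        for.\<close>
      using mobius_eq_sphere_boost(2)[of z "SOME i. i \<in> Basis"] z
      by (simp add: P_def some_in_eq)
    ultimately show "z = p /\<^sub>R (1 + hgt p)"
      by simp
  qed
qed

end

section \<open>Surface measure\<close>

lemma measurable_surface_measure: "(\<lambda>y. y) \<in> borel_measurable surface_measure"
proof -
  have "(\<lambda>y. y) \<in> restrict_space borel (sphere 0 1) \<rightarrow>\<^sub>M borel"
    by (intro measurable_restrict_space1 measurable_ident_sets refl)
  then show ?thesis
    unfolding surface_measure_def
    by (intro measurable_completion) (simp cong: measurable_cong_sets)
qed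

text \<open>The cone over a point of the sphere lies in a line, which has volume zero in dimension
  at least 2.\<close>

lemma AE_surface_measure_neq:
  fixes a :: "'a::euclidean_space"
  assumes "DIM('a) \<ge> 2"
  shows "AE y in surface_measure. y \<noteq> a"
proof (cases "a \<in> sphere 0 1")
  case True
  have "dim {a} < DIM('a)"
    using assms by simp
  then have "negligible (span {a})"
    by (intro negligible_lowdim) (simp add: dim_span)
  moreover have borel: "span {a} \<in> sets borel"
    by (intro borel_closed closed_span)
  ultimately have "span {a} \<in> null_sets lborel"
    by (simp add: negligible_iff_null_sets null_sets_completion_iff)
  moreover
  have "{r *\<^sub>R y | r y. 0 < r \<and> r < 1 \<and> y \<in> {a}} \<subseteq> span {a}"
    by (auto intro: span_mul span_base)
  then have "emeasure lborel {r *\<^sub>R y | r y. 0 < r \<and> r < 1 \<and> y \<in> {a}}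
      \<le> emeasure lborel (span {a})"
    using borel by (intro emeasure_mono) auto
  ultimately have "emeasure lborel {r *\<^sub>R y | r y. 0 < r \<and> r < 1 \<and> y \<in> {a}} = 0"
    by (simp only: null_setsD1 le_zero_eq)
  then have "emeasure surface_measure {a} = 0"
    using True by (subst emeasure_surface_measure) auto
  moreover have "{a} \<in> sets surface_measure"
    using measurable_sets[OF measurable_surface_measure, of "{a}"] True by simp
  ultimately have "{a} \<in> null_sets surface_measure"
    by auto
  then show ?thesis
    by (rule AE_I') auto
next
  case False
  then show ?thesis
    by (intro AE_I2) auto
qed

theorem corollary6:
  fixes f :: "real ^ 'n \<Rightarrow> real"
  assumes "CARD('n) \<ge> 2"
    and "\<And>y. y \<in> sphere 0 1 \<Longrightarrow> f y \<ge> 0"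
    and "integrable surface_measure f"
    and "(\<integral>y. f y \<partial>surface_measure) > 0"
  shows "\<exists>!x. x \<in> ball 0 1 \<and> (\<integral>y. f y *\<^sub>R mobius x y \<partial>surface_measure) = 0"
proof -
  define S :: "(real ^ 'n) measure" where "S = surface_measure"
  have S: "space S = sphere 0 1" "(\<lambda>y. y) \<in> borel_measurable S"
    by (simp_all add: S_def measurable_surface_measure)
  note [measurable] = S(2)
  have f [measurable]: "f \<in> borel_measurable S" "integrable S f"
    using assms(3) by (auto simp: S_def)
  have nonneg: "AE y in S. 0 \<le> f y"
    using assms(2) by (intro AE_I2) (simp add: S)
  \<comment> \<open>The density is \<open>f\<close> coerced to \<open>ennreal\<close>; as
    \<open>f\<close> is nonnegative on the sphere, nothing is truncated and the total mass is the
    integral of \<open>f\<close>.\<close>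
  define \<nu> where "\<nu> = density S f"
  have total: "emeasure \<nu> (space \<nu>) = ennreal (\<integral>y. f y \<partial>S)"
    unfolding \<nu>_def using f nonneg
    by (simp add: emeasure_density nn_integral_eq_integral cong: nn_integral_cong)
  interpret finite_measure \<nu>
    by (rule finite_measureI) (simp add: total)
  interpret diffuse_sphere_measure \<nu>
  proof
    show "space \<nu> = sphere 0 1"
      by (simp add: \<nu>_def S)
    show "(\<lambda>y. y) \<in> borel_measurable \<nu>"
      by (simp add: \<nu>_def S)
    show "AE y in \<nu>. y \<noteq> a" for a
    proof -
      have "AE y in S. y \<noteq> a"
        unfolding S_def by (rule AE_surface_measure_neq) (use assms(1) in simp)
      then show ?thesis
        unfolding \<nu>_def by (subst AE_density) auto
    qed
    show "measure \<nu> (space \<nu>) > 0"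
      using assms(4) by (simp add: measure_def total S_def)
  qed
  have "(\<integral>y. mobius x y \<partial>\<nu>) = (\<integral>y. f y *\<^sub>R mobius x y \<partial>S)" for x
    unfolding \<nu>_def
  proof (rule integral_density)
    show "mobius x \<in> borel_measurable S"
      unfolding mobius_def[abs_def] by measurable
  qed (use f nonneg in auto)
  then show ?thesis
    using ex1_conformal_barycenter by (simp add: S_def)
qed

end
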